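(* Let $n\geq 3$ and let $S=\{r_1,\dots,r_n\}$ be a set of integers with $2\leq r_1<r_2<\dots<r_n$, and suppose that $S$ contains at least one even integer. Then $S\subsetneqq \mathrm{Fall}(K_{r_1}\times K_{r_2}\times\cdots\times K_{r_n})$, and moreover $\mathrm{Fall}(K_{r_1}\times K_{r_2}\times\cdots\times K_{r_n})$ contains an integer greater than $r_n$.
   Context: All graphs are finite, simple (undirected, no loops, no multiple edges), with nonempty vertex set. For $k\in\mathbb{N}=\{1,2,\dots\}$ let $[k]=\{1,\dots,k\}$. A (proper) $k$-coloring of a graph $G$ is a function $f:V(G)\to[k]$ such that each $f^{-1}(i)$ is an independent set. It is a fall $k$-coloring if $f(N[v])=[k]$ for every $v\in V(G)$, where $N[v]$ is the closed neighborhood of $v$. $\mathrm{Fall}(G)$ is the set of all positive integers $k$ such that $G$ has a fall $k$-coloring. $K_r$ is the complete graph on $r$ vertices. The categorical product $G_1\times G_2$ has vertex set $V(G_1)\times V(G_2)$, with $(x_1,y_1)$ adjacent to $(x_2,y_2)$ iff $\{x_1,x_2\}\in E(G_1)$ and $\{y_1,y_2\}\in E(G_2)$; it is associative and commutative up to isomorphism, and $n$-fold products are formed accordingly (vertices are $n$-tuples, adjacent iff adjacent in every coordinate). *)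

theory Defs
  imports "Graph_Theory.Graph_Theory" "HOL-Library.FuncSet"
begin

text \<open>
  Finite simple undirected graphs are represented as in the theory \<^theory>\<open>Graph_Theory.Pair_Digraph\<close>:
  an undirected edge is a pair of opposite arcs, and the locale \<^locale>\<open>pair_graph\<close> expresses
  finiteness, symmetry and absence of loops.
\<close>

definition closed_nbhd :: "'a pair_pre_digraph \<Rightarrow> 'a \<Rightarrow> 'a set" where
  "closed_nbhd G v = insert v {u. (v, u) \<in> parcs G}"

definition independent_set :: "'a pair_pre_digraph \<Rightarrow> 'a set \<Rightarrow> bool" where
  "independent_set G A \<longleftrightarrow> A \<subseteq> pverts G \<and> (\<forall>u\<in>A. \<forall>v\<in>A. (u, v) \<notin> parcs G)"

definition coloring :: "'a pair_pre_digraph \<Rightarrow> nat \<Rightarrow> ('a \<Rightarrow> nat) \<Rightarrow> bool" where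
  "coloring G k f \<longleftrightarrow>
     f \<in> pverts G \<rightarrow> {1..k} \<and> (\<forall>i\<in>{1..k}. independent_set G {v \<in> pverts G. f v = i})"

definition fall_coloring :: "'a pair_pre_digraph \<Rightarrow> nat \<Rightarrow> ('a \<Rightarrow> nat) \<Rightarrow> bool" where
  "fall_coloring G k f \<longleftrightarrow>
     coloring G k f \<and> (\<forall>v\<in>pverts G. f ` closed_nbhd G v = {1..k})"

definition Fall :: "'a pair_pre_digraph \<Rightarrow> nat set" where
  "Fall G = {k. 0 < k \<and> (\<exists>f. fall_coloring G k f)}"

definition complete_graph :: "nat \<Rightarrow> nat pair_pre_digraph" where
  "complete_graph r =
     \<lparr> pverts = {1..r}, parcs = {(u, v). u \<in> {1..r} \<and> v \<in> {1..r} \<and> u \<noteq> v} \<rparr>"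

text \<open>
  In the product of a family of graphs, tuples are functions on the index set that are
  \<^const>\<open>undefined\<close> outside it. The index set is meant to be nonempty (for the empty index set
  the only vertex, the empty tuple, would carry a loop).
\<close>

definition categorical_product ::
    "'i set \<Rightarrow> ('i \<Rightarrow> 'a pair_pre_digraph) \<Rightarrow> ('i \<Rightarrow> 'a) pair_pre_digraph" where
  "categorical_product I G =
     \<lparr> pverts = Pi\<^sub>E I (\<lambda>i. pverts (G i)),
       parcs = {(x, y). x \<in> Pi\<^sub>E I (\<lambda>i. pverts (G i)) \<and> y \<in> Pi\<^sub>E I (\<lambda>i. pverts (G i)) \<and>
                        (\<forall>i\<in>I. (x i, y i) \<in> parcs (G i))} \<rparr>"

lemma complete_digraph_complete_graph: "complete_digraph r (with_proj (complete_graph r))"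
  by (auto simp: complete_digraph_pair_def complete_graph_def)

lemma pair_graph_complete_graph: "pair_graph (complete_graph r)"
  using complete_digraph_complete_graph by (rule pair_graphI_complete)

lemma pair_graph_categorical_product:
  assumes "finite I" "I \<noteq> {}" and G: "\<And>i. i \<in> I \<Longrightarrow> pair_graph (G i)"
  shows "pair_graph (categorical_product I G)"
proof -
  have fin: "finite (Pi\<^sub>E I (\<lambda>i. pverts (G i)))"
  proof (rule finite_PiE[OF \<open>finite I\<close>])
    fix i assume "i \<in> I"
    then interpret pair_graph "G i" by (rule G)
    show "finite (pverts (G i))" by (rule pair_finite_verts)
  qed
  have arcs: "parcs (categorical_product I G) \<subseteq>
      Pi\<^sub>E I (\<lambda>i. pverts (G i)) \<times> Pi\<^sub>E I (\<lambda>i. pverts (G i))"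
    by (auto simp: categorical_product_def)
  have sy: "(b, a) \<in> parcs (G i)" if "i \<in> I" "(a, b) \<in> parcs (G i)" for a b i
  proof -
    interpret pair_graph "G i" using that(1) by (rule G)
    show ?thesis using that(2) by (rule arcs_symmetric)
  qed
  have irr: "(a, a) \<notin> parcs (G i)" if "i \<in> I" for a i
  proof -
    interpret pair_graph "G i" using that by (rule G)
    show ?thesis by (auto dest: no_loops')
  qed
  show ?thesis
  proof unfold_locales
    show "finite (parcs (categorical_product I G))"
      by (rule finite_subset[OF arcs finite_cartesian_product[OF fin fin]])
    show "symmetric (with_proj (categorical_product I G))"
      unfolding symmetric_def with_proj_simps
      by (rule symI) (simp add: categorical_product_def sy)
    show "fst e \<noteq> snd e" if "e \<in> parcs (categorical_product I G)" for e
    proof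
      obtain i where "i \<in> I" using \<open>I \<noteq> {}\<close> by blast
      assume "fst e = snd e"
      with that \<open>i \<in> I\<close> have "(fst e i, fst e i) \<in> parcs (G i)"
        by (auto simp: categorical_product_def)
      with irr[OF \<open>i \<in> I\<close>] show False by blast
    qed
    show "finite (pverts (categorical_product I G))"
      using fin by (simp add: categorical_product_def)
    show "fst e \<in> pverts (categorical_product I G)" "snd e \<in> pverts (categorical_product I G)"
      if "e \<in> parcs (categorical_product I G)" for e
      using that arcs by (auto simp: categorical_product_def)
  qed
qed

end

theory Submission
  imports Defs
begin

text \<open>
  An independent dominating set of a product of complete graphs is a maximal family of tuples any
  two of which agree in some coordinate. Every hyperplane \<open>x k = c\<close> is one, so projections are
  fall colorings. Another one is the Pasch configuration, the four words of one fixed parity in a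
  \<open>2 \<times> 2 \<times> 2\<close> subbox of three coordinates. A box \<open>2 \<times> m \<times> 2\<close> splits into \<open>m\<close> Pasch
  configurations: each of its \<open>m\<close> layers consists of an even and an odd diagonal, and the even
  diagonal of a layer is joined to the odd diagonal of the cyclically preceding layer. If
  \<open>r i = 2 * a\<close> is even, then the slab \<open>x k \<in> {1, 2}\<close> is thus cut into \<open>a * r j\<close> classes, and the
  hyperplanes \<open>x k = c\<close> with \<open>c \<ge> 3\<close> take care of the rest. For suitable \<open>i, j, k\<close> this
  gives \<open>a * r j + r k - 2 > r n\<close> colors.
\<close>

text \<open>Renaming colors along a bijection onto \<open>{1..card C}\<close> changes nothing, so
  the colorings below may take values in any finite set, such as pairs or a sum type.\<close>

lemma card_in_Fall:
  assumes "finite C" "C \<noteq> {}"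
    and col: "\<And>v. v \<in> pverts G \<Longrightarrow> f v \<in> C"
    and proper: "\<And>u v. \<lbrakk>u \<in> pverts G; v \<in> pverts G; (u, v) \<in> parcs G\<rbrakk> \<Longrightarrow> f u \<noteq> f v"
    and dom: "\<And>v. v \<in> pverts G \<Longrightarrow> f ` closed_nbhd G v = C"
  shows "card C \<in> Fall G"
proof -
  obtain h where h: "bij_betw h C {1..card C}"
    using ex_bij_betw_finite_nat[OF \<open>finite C\<close>] bij_betw_same_card
    by (metis \<open>finite C\<close> card_atLeastAtMost diff_Suc_1 finite_atLeastAtMost finite_same_card_bij)
  then have "inj_on h C" and himg: "h ` C = {1..card C}"
    by (auto simp: bij_betw_def)
  have "fall_coloring G (card C) (h \<circ> f)"
    unfolding fall_coloring_def coloring_def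
  proof (intro conjI ballI)
    show "h \<circ> f \<in> pverts G \<rightarrow> {1..card C}"
      using col himg by auto
    show "independent_set G {v \<in> pverts G. (h \<circ> f) v = i}" for i
      using proper col inj_onD[OF \<open>inj_on h C\<close>] by (fastforce simp: independent_set_def)
    show "(h \<circ> f) ` closed_nbhd G v = {1..card C}" if "v \<in> pverts G" for v
      using dom[OF that] himg by (metis image_comp)
  qed
  moreover have "0 < card C"
    using assms(1,2) by (simp add: card_gt_0_iff)
  ultimately show ?thesis
    by (auto simp: Fall_def)
qed

text \<open>
  A coloring which depends only on the coordinates in \<open>J\<close> need only be examined there: in the
  remaining coordinates a neighbor can always differ, since all factors have two vertices.
\<close>

lemma card_in_Fall_complete_product:
  fixes I :: "'i set" and r :: "'i \<Rightarrow> nat" and f :: "('i \<Rightarrow> nat) \<Rightarrow> 'c"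
  defines "V \<equiv> Pi\<^sub>E I (\<lambda>i. {1..r i})"
  assumes r: "\<And>i. i \<in> I \<Longrightarrow> 2 \<le> r i" and "J \<subseteq> I" and C: "finite C" "C \<noteq> {}"
    and col: "\<And>x. x \<in> V \<Longrightarrow> f x \<in> C"
    and proper: "\<And>x y. \<lbrakk>x \<in> V; y \<in> V; \<And>i. i \<in> I \<Longrightarrow> x i \<noteq> y i\<rbrakk> \<Longrightarrow> f x \<noteq> f y"
    and dom: "\<And>x c. \<lbrakk>x \<in> V; c \<in> C; f x \<noteq> c\<rbrakk> \<Longrightarrow>
      \<exists>y. (\<forall>i\<in>J. y i \<in> {1..r i} \<and> x i \<noteq> y i) \<and> (\<forall>z. (\<forall>i\<in>J. z i = y i) \<longrightarrow> f z = c)"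
  shows "card C \<in> Fall (categorical_product I (\<lambda>i. complete_graph (r i)))"
proof (rule card_in_Fall[OF C, where f = f])
  let ?G = "categorical_product I (\<lambda>i. complete_graph (r i))"
  have verts: "pverts ?G = V"
    by (simp add: categorical_product_def complete_graph_def V_def)
  have arcs: "(x, y) \<in> parcs ?G \<longleftrightarrow> x \<in> V \<and> y \<in> V \<and> (\<forall>i\<in>I. x i \<noteq> y i)" for x y
    by (auto simp: categorical_product_def complete_graph_def V_def dest: PiE_mem)
  show "f v \<in> C" if "v \<in> pverts ?G" for v
    using that col verts by simp
  show "f u \<noteq> f v" if "(u, v) \<in> parcs ?G" for u v
    using that proper arcs by blast
  show "f ` closed_nbhd ?G x = C" if "x \<in> pverts ?G" for x
  proof
    have x: "x \<in> V"
      using that verts by simp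
    show "f ` closed_nbhd ?G x \<subseteq> C"
      using col x by (auto simp: closed_nbhd_def arcs)
    show "C \<subseteq> f ` closed_nbhd ?G x"
    proof
      fix c assume "c \<in> C"
      show "c \<in> f ` closed_nbhd ?G x"
      proof (cases "f x = c")
        case True
        then show ?thesis by (auto simp: closed_nbhd_def)
      next
        case False
        with dom[OF x \<open>c \<in> C\<close>] obtain y where
          y: "\<And>i. i \<in> J \<Longrightarrow> y i \<in> {1..r i} \<and> x i \<noteq> y i"
          and yc: "\<And>z. (\<forall>i\<in>J. z i = y i) \<Longrightarrow> f z = c"
          by blast
        define z where
          "z = (\<lambda>i\<in>I. if i \<in> J then y i else if x i = 1 then 2 else 1)"
        have "f z = c"
          using \<open>J \<subseteq> I\<close> by (intro yc) (auto simp: z_def)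
        moreover have "z \<in> V"
          using y r by (force simp: V_def z_def)
        moreover have "x i \<noteq> z i" if "i \<in> I" for i
          using y that by (auto simp: z_def)
        ultimately show ?thesis
          using x by (auto simp: closed_nbhd_def arcs)
      qed
    qed
  qed
qed

lemma factor_order_in_Fall:
  fixes r :: "'i \<Rightarrow> nat"
  assumes "\<And>i. i \<in> I \<Longrightarrow> 2 \<le> r i" and "j \<in> I"
  shows "r j \<in> Fall (categorical_product I (\<lambda>i. complete_graph (r i)))"
proof -
  have "card {1..r j} \<in> Fall (categorical_product I (\<lambda>i. complete_graph (r i)))"
  proof (rule card_in_Fall_complete_product[where J = "{j}" and f = "\<lambda>x. x j"])
    show "{1..r j} \<noteq> {}"
      using assms(1)[OF assms(2)] by simp
    show "\<exists>y. (\<forall>i\<in>{j}. y i \<in> {1..r i} \<and> x i \<noteq> y i) \<and> (\<forall>z. (\<forall>i\<in>{j}. z i = y i) \<longrightarrow> z j = c)"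
      if "c \<in> {1..r j}" "x j \<noteq> c" for x c
      using that by (intro exI[of _ "\<lambda>_. c"]) auto
  qed (use assms in \<open>auto dest: PiE_mem\<close>)
  then show ?thesis by simp
qed

text \<open>The admissible \<open>(u', w')\<close> are the two cells of one diagonal of the square
  with sides {2t-1, 2t} and {1, 2}. They share no coordinate, so \<open>(u, w)\<close> can block
  both only by taking one coordinate from each, that is, by lying on the other diagonal. This is
  what the second hypothesis excludes.\<close>

lemma exists_avoiding_of_parity:
  fixes u w t :: nat
  assumes "1 \<le> t"
    and "\<not> ((u + 1) div 2 = t \<and> w \<in> {1, 2} \<and> even (u + w) \<noteq> P)"
  shows "\<exists>u' w'. u' \<in> {1..2 * t} \<and> (u' + 1) div 2 = t \<and> w' \<in> {1, 2} \<and> u \<noteq> u' \<and> w \<noteq> w' \<and>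
    even (u' + w') = P"
proof -
  let ?Q = "\<lambda>u' w'. u' \<in> {1..2 * t} \<and> (u' + 1) div 2 = t \<and> w' \<in> {1, 2} \<and> u \<noteq> u' \<and> w \<noteq> w' \<and>
    even (u' + w') = P"
  have "?Q (2 * t) 1 \<or> ?Q (2 * t) 2 \<or> ?Q (2 * t - 1) 1 \<or> ?Q (2 * t - 1) 2"
    using assms by (cases P) (simp_all, presburger+)
  then show ?thesis by blast
qed

text \<open>Coordinate \<open>i\<close> supplies the \<open>a\<close> pairs of values,
  \<open>j\<close> the layers and \<open>k\<close> the slab. As \<open>2 \<le> r k\<close>, the
  truncated subtraction counts the remaining hyperplanes exactly.\<close>

lemma pasch_in_Fall:
  fixes r :: "'i \<Rightarrow> nat"
  assumes r: "\<And>i. i \<in> I \<Longrightarrow> 2 \<le> r i"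
    and I: "i \<in> I" "j \<in> I" "k \<in> I" and distinct: "i \<noteq> j" "i \<noteq> k" "j \<noteq> k"
    and a: "r i = 2 * a"
  shows "a * r j + (r k - 2) \<in> Fall (categorical_product I (\<lambda>i. complete_graph (r i)))"
proof -
  define m where "m = r j"
  have "2 \<le> m" "1 \<le> a"
    using r[OF I(1)] r[OF I(2)] a by (auto simp: m_def)
  \<comment> \<open>The cyclic successor on {1, ..., m}. It is a bijection without fixed points, so
    each class joins diagonals of two different layers.\<close>
  define \<sigma> where "\<sigma> v = (if v = m then 1 else v + 1)" for v
  have \<sigma>_mem: "\<sigma> v \<in> {1..m}" if "v \<in> {1..m}" for v
    using that by (auto simp: \<sigma>_def)
  have \<sigma>_fix: "\<sigma> v \<noteq> v" for v
    using \<open>2 \<le> m\<close> by (auto simp: \<sigma>_def)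
  have \<sigma>_inj: "v = v'" if "\<sigma> v = \<sigma> v'" "v \<in> {1..m}" "v' \<in> {1..m}" for v v'
    using that by (cases "v = m"; cases "v' = m") (simp_all add: \<sigma>_def)
  have \<sigma>_surj: "\<exists>v\<in>{1..m}. \<sigma> v = b" if "b \<in> {1..m}" for b
  proof (cases "b = 1")
    case True
    then show ?thesis using \<open>2 \<le> m\<close> by (intro bexI[of _ m]) (auto simp: \<sigma>_def)
  next
    case False
    then show ?thesis using that by (intro bexI[of _ "b - 1"]) (auto simp: \<sigma>_def)
  qed
  \<comment> \<open>The number \<open>(x i + 1) div 2\<close> is t exactly for \<open>x i\<close> in
    {2t-1, 2t}. The class \<open>Inl (t, b)\<close> is the even diagonal of layer \<open>b\<close>
    together with the odd diagonal of the layer whose successor is \<open>b\<close>.\<close>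
  define f :: "('i \<Rightarrow> nat) \<Rightarrow> (nat \<times> nat) + nat" where
    "f x = (if x k \<in> {1, 2}
            then Inl ((x i + 1) div 2, if even (x i + x k) then x j else \<sigma> (x j))
            else Inr (x k))" for x
  define C where "C = ({1..a} \<times> {1..m}) <+> {3..r k}"
  have mem: "x i \<in> {1..2 * a}" "x j \<in> {1..m}" "x k \<in> {1..r k}"
    if "x \<in> Pi\<^sub>E I (\<lambda>i. {1..r i})" for x
    using PiE_mem[OF that I(1)] PiE_mem[OF that I(2)] PiE_mem[OF that I(3)] a
    by (simp_all add: m_def)
  have "card C \<in> Fall (categorical_product I (\<lambda>i. complete_graph (r i)))"
  proof (rule card_in_Fall_complete_product[where J = "{i, j, k}" and f = f])
    show "finite C" "C \<noteq> {}"
      using \<open>2 \<le> m\<close> \<open>1 \<le> a\<close> by (auto simp: C_def)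
    show "{i, j, k} \<subseteq> I"
      using I by simp
  next
    fix x assume "x \<in> Pi\<^sub>E I (\<lambda>i. {1..r i})"
    then have x: "x i \<in> {1..2 * a}" "x j \<in> {1..m}" "x k \<in> {1..r k}"
      using mem by blast+
    have "(x i + 1) div 2 \<in> {1..a}"
      using x(1) by auto
    moreover have "(if even (x i + x k) then x j else \<sigma> (x j)) \<in> {1..m}"
      using x(2) \<sigma>_mem by simp
    moreover have "x k \<in> {3..r k}" if "x k \<notin> {1, 2}"
      using x(3) that by auto
    ultimately show "f x \<in> C"
      unfolding f_def C_def by (simp only: InlI InrI SigmaI split: if_split) blast
  next
    fix x y
    assume "x \<in> Pi\<^sub>E I (\<lambda>i. {1..r i})" "y \<in> Pi\<^sub>E I (\<lambda>i. {1..r i})"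
    then have x: "x j \<in> {1..m}" and y: "y j \<in> {1..m}"
      using mem by blast+
    assume "\<And>i. i \<in> I \<Longrightarrow> x i \<noteq> y i"
    then have ne: "x i \<noteq> y i" "x j \<noteq> y j" "x k \<noteq> y k"
      using I by auto
    show "f x \<noteq> f y"
    proof
      assume eq: "f x = f y"
      then have k: "x k \<in> {1, 2}" "y k \<in> {1, 2}"
        using ne by (auto simp: f_def split: if_splits)
      with eq have i: "(x i + 1) div 2 = (y i + 1) div 2"
        by (auto simp: f_def)
      \<comment> \<open>Distinct members of one pair differ in parity. The changes in coordinates
        \<open>i\<close> and \<open>k\<close> cancel in the sum, so both vertices fall under the
        same branch of \<open>f\<close>, which is injective in coordinate \<open>j\<close>.\<close>
      have "even (x i) \<noteq> even (y i)"
        using i ne(1) by presburger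
      moreover have "even (x k) \<noteq> even (y k)"
        using k ne(3) by auto
      ultimately have "even (x i + x k) = even (y i + y k)"
        by auto
      with eq k have "x j = y j \<or> \<sigma> (x j) = \<sigma> (y j)"
        by (auto simp: f_def split: if_splits)
      then show False
        using \<sigma>_inj x y ne(2) by blast
    qed
  next
    fix x c
    assume c: "c \<in> C" "f x \<noteq> c"
    have "\<exists>u v w. u \<in> {1..2 * a} \<and> v \<in> {1..m} \<and> w \<in> {1..r k} \<and> x i \<noteq> u \<and> x j \<noteq> v \<and> x k \<noteq> w \<and>
      (\<forall>z. z i = u \<longrightarrow> z j = v \<longrightarrow> z k = w \<longrightarrow> f z = c)"
    proof (cases c)
      case (Inr d)
      have ex_ne: "\<exists>u\<in>{1..l}. y \<noteq> u" if "2 \<le> l" for l y :: nat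
        using that by (intro bexI[of _ "if y = 1 then 2 else 1"]) auto
      have "\<exists>u\<in>{1..2 * a}. x i \<noteq> u" "\<exists>v\<in>{1..m}. x j \<noteq> v"
        using \<open>1 \<le> a\<close> \<open>2 \<le> m\<close> by (intro ex_ne; simp)+
      moreover have d: "d \<in> {3..r k}"
        using c Inr by (auto simp: C_def)
      moreover have "x k \<noteq> d"
        using c Inr d by (auto simp: f_def)
      moreover have "f z = c" if "z k = d" for z
        using that d Inr by (simp add: f_def)
      moreover have "d \<in> {1..r k}"
        using d by simp
      ultimately show ?thesis
        by blast
    next
      case (Inl p)
      obtain t b where p: "p = (t, b)" by fastforce
      have t: "t \<in> {1..a}" and b: "b \<in> {1..m}"
        using c Inl p by (auto simp: C_def)
      obtain b' where b': "b' \<in> {1..m}" "\<sigma> b' = b"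
        using \<sigma>_surj[OF b] by blast
      then have "b' \<noteq> b"
        using \<sigma>_fix by blast
      \<comment> \<open>\<open>?bad P\<close> says that \<open>x\<close> lies, in coordinates
        \<open>i\<close> and \<open>k\<close>, on the diagonal opposite to the one of parity
        \<open>P\<close>, where no cell of the latter can be reached.\<close>
      let ?bad = "\<lambda>P. (x i + 1) div 2 = t \<and> x k \<in> {1, 2} \<and> even (x i + x k) \<noteq> P"
      have "\<not> (?bad False \<and> x j = b)" "\<not> (?bad True \<and> x j = b')"
        using c(2) Inl p b' by (auto simp: f_def split: if_splits)
      \<comment> \<open>The target is the even diagonal of layer \<open>b\<close> or the odd one of
        layer \<open>b'\<close>. If \<open>x j = b\<close>, the odd one works, since
        \<open>x\<close> would otherwise have color \<open>c\<close>. If not, the even one works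
        unless \<open>?bad True\<close>; then \<open>x j \<noteq> b'\<close>, and
        \<open>?bad False\<close> fails by parity.\<close>
      then obtain P v where good: "\<not> ?bad P" and v: "v = (if P then b else b')" "x j \<noteq> v"
        using \<open>b' \<noteq> b\<close> by (cases "x j = b"; cases "?bad True") metis+
      have "1 \<le> t"
        using t by simp
      from exists_avoiding_of_parity[OF this good] obtain u w where
        u: "u \<in> {1..2 * t}" "(u + 1) div 2 = t" "x i \<noteq> u"
        and w: "w \<in> {1, 2}" "x k \<noteq> w" and P: "even (u + w) = P"
        by blast
      have "u \<in> {1..2 * a}" "w \<in> {1..r k}" "v \<in> {1..m}"
        using u(1) t w(1) r[OF I(3)] v b b' by auto
      moreover have "f z = c" if "z i = u" "z j = v" "z k = w" for z
        unfolding f_def that Inl p using u(2) w(1) P v(1) b'(2) by simp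
      ultimately show ?thesis
        using u(3) v(2) w(2) by blast
    qed
    then obtain u v w where
      "u \<in> {1..2 * a}" "v \<in> {1..m}" "w \<in> {1..r k}" "x i \<noteq> u" "x j \<noteq> v" "x k \<noteq> w"
      "\<And>z. z i = u \<Longrightarrow> z j = v \<Longrightarrow> z k = w \<Longrightarrow> f z = c"
      by blast
    then show "\<exists>y. (\<forall>l\<in>{i, j, k}. y l \<in> {1..r l} \<and> x l \<noteq> y l) \<and>
        (\<forall>z. (\<forall>l\<in>{i, j, k}. z l = y l) \<longrightarrow> f z = c)"
      using distinct a by (intro exI[of _ "x(i := u, j := v, k := w)"]) (auto simp: m_def)
  qed (rule r)
  moreover have "card C = a * r j + (r k - 2)"
    by (simp add: C_def card_Plus card_cartesian_product m_def)
  ultimately show ?thesis by simp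
qed

theorem theorem8:
  fixes n :: nat and r :: "nat \<Rightarrow> nat" and S :: "nat set"
  assumes "n \<ge> 3"
    and "S = r ` {1..n}"
    and "2 \<le> r 1"
    and "strict_mono_on {1..n} r"
    and "\<exists>s\<in>S. even s"
  shows "S \<subset> Fall (categorical_product {1..n} (\<lambda>i. complete_graph (r i))) \<and>
         (\<exists>k \<in> Fall (categorical_product {1..n} (\<lambda>i. complete_graph (r i))). k > r n)"
proof -
  let ?F = "Fall (categorical_product {1..n} (\<lambda>i. complete_graph (r i)))"
  have less: "r i < r j" if "1 \<le> i" "i < j" "j \<le> n" for i j
    using strict_mono_onD[OF assms(4)] that by simp
  have le: "r i \<le> r j" if "1 \<le> i" "i \<le> j" "j \<le> n" for i j
    using less that by (cases "i = j") (auto intro: less_imp_le)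
  have r: "2 \<le> r i" if "i \<in> {1..n}" for i
    using le[of 1 i] assms(3) that by simp
  have "S \<subseteq> ?F"
    using factor_order_in_Fall[of "{1..n}" r] r assms(2) by blast
  obtain i a where i: "i \<in> {1..n}" and a: "r i = 2 * a"
    using assms(2,5) by (auto elim!: evenE)
  have "1 \<le> a"
    using r[OF i] a by simp
  have "\<exists>j k. j \<in> {1..n} \<and> k \<in> {1..n} \<and> i \<noteq> j \<and> i \<noteq> k \<and> j \<noteq> k \<and> r n < a * r j + (r k - 2)"
  proof (cases "i = n")
    case True
    \<comment> \<open>With \<open>r n = 2 * a\<close>, a factor of at least 3 beside
      \<open>a\<close> already exceeds \<open>r n\<close>, even if \<open>r (n - 2) - 2\<close>
      vanishes.\<close>
    have "3 \<le> r (n - 1)"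
      using less[of "n - 2" "n - 1"] r[of "n - 2"] assms(1) by force
    then have "a * 3 \<le> a * r (n - 1)"
      by simp
    then have "r n < a * r (n - 1) + (r (n - 2) - 2)"
      using a \<open>1 \<le> a\<close> unfolding True by linarith
    then show ?thesis
      using True assms(1) by (intro exI[of _ "n - 1"] exI[of _ "n - 2"]) auto
  next
    case False
    \<comment> \<open>With \<open>k = n\<close> it remains to beat the lost 2, for which any
      \<open>j\<close> other than \<open>i\<close> and \<open>n\<close> serves. If
      \<open>a = 1\<close>, then \<open>r i = 2\<close> forces \<open>r j \<ge> 3\<close>; otherwise
      both factors are at least 2.\<close>
    define j where "j = (if i = 1 then 2 else 1 :: nat)"
    have j: "j \<in> {1..n}" "i \<noteq> j" "j \<noteq> n"
      using assms(1) by (auto simp: j_def)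
    have "r i \<noteq> r j"
      using less[of i j] less[of j i] i j by (cases i j rule: linorder_cases) auto
    then have "2 < a * r j"
    proof (cases "a = 1")
      case False
      then have "2 * 2 \<le> a * r j"
        using \<open>1 \<le> a\<close> r[OF j(1)] by (intro mult_le_mono) auto
      then show ?thesis by simp
    qed (use a r[OF j(1)] in auto)
    then have "r n < a * r j + (r n - 2)"
      using r[of n] assms(1) by simp
    then show ?thesis
      using j False assms(1) by (intro exI[of _ j] exI[of _ n]) auto
  qed
  then obtain j k where jk: "j \<in> {1..n}" "k \<in> {1..n}" "i \<noteq> j" "i \<noteq> k" "j \<noteq> k"
    and gt: "r n < a * r j + (r k - 2)"
    by blast
  have new: "a * r j + (r k - 2) \<in> ?F"
    using pasch_in_Fall[of "{1..n}" r i j k a] r i jk a by blast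
  moreover have "a * r j + (r k - 2) \<notin> S"
    using gt le[of _ n] assms(2) by force
  ultimately show ?thesis
    using \<open>S \<subseteq> ?F\<close> gt by blast
qed

end
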